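(* Let $\mathcal{P}=\{x\in\mathbb{R}^n:\langle a_i,x\rangle\le b_i\ \forall i\in[m]\}$ be a polytope and fix $x\in\mathcal{P}$. Let $F=\{z\in\mathcal{P}:A_{I(x)}z=b_{I(x)}\}$ be the minimal face containing $x$. Let $\delta_{\max}=\max\{\delta:x-\delta d_x^\Pi\in\mathcal{P}\}$ and consider the away point $a_x=x-\delta_{\max}d_x^\Pi$ obtained by moving maximally along the direction of the negative shadow. Then $a_x$ lies in $F$ and the corresponding away-direction is simply $x-a_x=\delta_{\max}d_x^\Pi$.
   Context: $h:\mathcal{P}\to\mathbb{R}$ is differentiable; $I(x)=\{i:\langle a_i,x\rangle=b_i\}$, and $A_{I(x)},b_{I(x)}$ are the corresponding rows and right-hand sides. $\Pi_{\mathcal{P}}$ is Euclidean projection and $d_x^\Pi=\lim_{\epsilon\downarrow0}\frac{\Pi_{\mathcal{P}}(x-\epsilon\nabla h(x))-x}{\epsilon}$ is the shadow of the negative gradient at $x$, equal to the Euclidean projection of $-\nabla h(x)$ onto $\{d:A_{I(x)}d\le0\}$. If $d_x^\Pi=0$, the maximum is not attained and $a_x$ is understood to be $x$. *)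

theory Defs
  imports "HOL-Analysis.Analysis"
begin

definition poly_set :: "nat \<Rightarrow> (nat \<Rightarrow> real ^ 'n) \<Rightarrow> (nat \<Rightarrow> real) \<Rightarrow> (real ^ 'n) set" where
  "poly_set m a b = {x. \<forall>i\<in>{1..m}. a i \<bullet> x \<le> b i}"

definition active :: "nat \<Rightarrow> (nat \<Rightarrow> real ^ 'n) \<Rightarrow> (nat \<Rightarrow> real) \<Rightarrow> real ^ 'n \<Rightarrow> nat set" where
  "active m a b x = {i\<in>{1..m}. a i \<bullet> x = b i}"

definition min_face :: "nat \<Rightarrow> (nat \<Rightarrow> real ^ 'n) \<Rightarrow> (nat \<Rightarrow> real) \<Rightarrow> real ^ 'n \<Rightarrow> (real ^ 'n) set" where
  "min_face m a b x = {z \<in> poly_set m a b. \<forall>i\<in>active m a b x. a i \<bullet> z = b i}"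

(* The argument G is the gradient field of the objective. *)
definition shadow :: "(real ^ 'n) set \<Rightarrow> (real ^ 'n \<Rightarrow> real ^ 'n) \<Rightarrow> real ^ 'n \<Rightarrow> real ^ 'n" where
  "shadow P G x = Lim (at_right 0) (\<lambda>\<epsilon>. (closest_point P (x - \<epsilon> *\<^sub>R G x) - x) /\<^sub>R \<epsilon>)"

(* GREATEST is an attained maximum; for d = 0 and x in P there is none, and the value is
   then an unspecified real. *)
definition max_away_step :: "(real ^ 'n) set \<Rightarrow> real ^ 'n \<Rightarrow> real ^ 'n \<Rightarrow> real" where
  "max_away_step P x d = (GREATEST \<delta>. x - \<delta> *\<^sub>R d \<in> P)"

definition away_point :: "(real ^ 'n) set \<Rightarrow> real ^ 'n \<Rightarrow> real ^ 'n \<Rightarrow> real ^ 'n" where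
  "away_point P x d = (if d = 0 then x else x - max_away_step P x d *\<^sub>R d)"

end

theory Submission
  imports Defs
begin

text \<open>
  Near \<open>x\<close> the polyhedron coincides with the translated cone \<open>x + C\<close>, where \<open>C\<close> is cut out by the
  homogeneous active constraints, so for small \<open>\<epsilon>\<close> projecting \<open>x - \<epsilon> g\<close> onto the polyhedron is
  the same as scaling by \<open>\<epsilon>\<close> the projection of \<open>- g\<close> onto \<open>C\<close>. The difference quotient defining
  the shadow is therefore eventually constant (\<open>closest_point_poly_set_small_step\<close>); in
  particular its limit exists and lies in \<open>C\<close>, that is, the shadow \<open>d\<close> satisfies
  \<open>a i \<bullet> d \<le> 0\<close> at every active constraint \<open>i\<close> (\<open>shadow_in_feasible_cone\<close>).

  Stepping backwards, \<open>x - \<delta> d\<close> with \<open>\<delta> \<ge> 0\<close> has \<open>a i \<bullet> (x - \<delta> d) \<ge> b i\<close> at an active \<open>i\<close>,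
  while membership in the polyhedron gives the reverse inequality. So every feasible backward
  step keeps the active constraints tight and stays in the minimal face. Compactness of the
  polytope provides the longest such step when \<open>d \<noteq> 0\<close>; when \<open>d = 0\<close> the away point is \<open>x\<close>
  and both claims are immediate.
\<close>

definition feasible_cone ::
  "nat \<Rightarrow> (nat \<Rightarrow> real ^ 'n) \<Rightarrow> (nat \<Rightarrow> real) \<Rightarrow> real ^ 'n \<Rightarrow> (real ^ 'n) set" where
  "feasible_cone m a b x = {v. \<forall>i\<in>active m a b x. a i \<bullet> v \<le> 0}"

lemma convex_poly_set: "convex (poly_set m a b)"
proof -
  have "poly_set m a b = (\<Inter>i\<in>{1..m}. {x. a i \<bullet> x \<le> b i})"
    by (auto simp: poly_set_def)
  then show ?thesis
    by (simp add: convex_INT convex_halfspace_le)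
qed

lemma closed_poly_set: "closed (poly_set m a b)"
proof -
  have "poly_set m a b = (\<Inter>i\<in>{1..m}. {x. a i \<bullet> x \<le> b i})"
    by (auto simp: poly_set_def)
  then show ?thesis
    by (simp add: closed_INT closed_halfspace_le)
qed

lemma closed_feasible_cone: "closed (feasible_cone m a b x)"
proof -
  have "feasible_cone m a b x = (\<Inter>i\<in>active m a b x. {v. a i \<bullet> v \<le> 0})"
    by (auto simp: feasible_cone_def)
  then show ?thesis
    by (simp add: closed_INT closed_halfspace_le)
qed

lemma feasible_cone_nonempty: "feasible_cone m a b x \<noteq> {}"
proof -
  have "0 \<in> feasible_cone m a b x"
    by (simp add: feasible_cone_def)
  then show ?thesis
    by blast
qed

lemma scaled_displacement_in_feasible_cone:
  assumes "z \<in> poly_set m a b" and "0 \<le> t"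
  shows "t *\<^sub>R (z - x) \<in> feasible_cone m a b x"
  using assms
  by (auto simp: feasible_cone_def poly_set_def active_def inner_diff_right
      intro!: mult_nonneg_nonpos)

text \<open>
  The active constraints bound all of the ray \<open>x + \<epsilon> v\<close>, and the finitely many inactive ones have
  slack at \<open>x\<close>, which a short step cannot use up.
\<close>

lemma eventually_feasible_step:
  assumes x: "x \<in> poly_set m a b" and v: "v \<in> feasible_cone m a b x"
  shows "\<forall>\<^sub>F \<epsilon> in at_right 0. x + \<epsilon> *\<^sub>R v \<in> poly_set m a b"
proof -
  have "\<forall>\<^sub>F \<epsilon> in at_right 0. a i \<bullet> (x + \<epsilon> *\<^sub>R v) \<le> b i" if i: "i \<in> {1..m}" for i
  proof (cases "i \<in> active m a b x")
    case True
    then have "a i \<bullet> x = b i" and "a i \<bullet> v \<le> 0"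
      using v by (auto simp: active_def feasible_cone_def)
    then have "a i \<bullet> (x + \<epsilon> *\<^sub>R v) \<le> b i" if "0 < \<epsilon>" for \<epsilon>
      using that by (simp add: inner_add_right mult_nonneg_nonpos)
    moreover have "\<forall>\<^sub>F \<epsilon> in at_right (0::real). 0 < \<epsilon>"
      by (rule eventually_at_right_less)
    ultimately show ?thesis
      by (auto elim: eventually_mono)
  next
    case False
    then have slack: "a i \<bullet> x < b i"
      using x i by (force simp: active_def poly_set_def)
    have "((\<lambda>\<epsilon>. a i \<bullet> (x + \<epsilon> *\<^sub>R v)) \<longlongrightarrow> a i \<bullet> (x + 0 *\<^sub>R v)) (at_right 0)"
      by (intro tendsto_intros)
    then have "\<forall>\<^sub>F \<epsilon> in at_right 0. a i \<bullet> (x + \<epsilon> *\<^sub>R v) < b i"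
      using slack by (intro order_tendstoD(2)) auto
    then show ?thesis
      by (auto elim: eventually_mono)
  qed
  then have "\<forall>\<^sub>F \<epsilon> in at_right 0. \<forall>i\<in>{1..m}. a i \<bullet> (x + \<epsilon> *\<^sub>R v) \<le> b i"
    by (intro eventually_ball_finite) auto
  then show ?thesis
    by (simp add: poly_set_def)
qed

text \<open>
  Once \<open>x + \<epsilon> p\<close> is feasible it beats every other \<open>z\<close> in the polyhedron, because \<open>(z - x) / \<epsilon>\<close> is
  a competitor of \<open>p\<close> in the cone, and rescaling by \<open>\<epsilon>\<close> preserves the comparison of distances.
\<close>

lemma closest_point_poly_set_small_step:
  fixes x g :: "real ^ 'n"
  assumes x: "x \<in> poly_set m a b"
  defines "p \<equiv> closest_point (feasible_cone m a b x) (- g)"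
  shows "\<forall>\<^sub>F \<epsilon> in at_right 0. closest_point (poly_set m a b) (x - \<epsilon> *\<^sub>R g) = x + \<epsilon> *\<^sub>R p"
proof -
  have p_in: "p \<in> feasible_cone m a b x"
    unfolding p_def by (intro closest_point_in_set closed_feasible_cone feasible_cone_nonempty)
  have "closest_point (poly_set m a b) (x - \<epsilon> *\<^sub>R g) = x + \<epsilon> *\<^sub>R p"
    if pos: "0 < \<epsilon>" and feasible: "x + \<epsilon> *\<^sub>R p \<in> poly_set m a b" for \<epsilon>
  proof -
    have "dist (x - \<epsilon> *\<^sub>R g) (x + \<epsilon> *\<^sub>R p) \<le> dist (x - \<epsilon> *\<^sub>R g) z"
      if z: "z \<in> poly_set m a b" for z
    proof -
      define w where "w = (1 / \<epsilon>) *\<^sub>R (z - x)"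
      have z_eq: "z = x + \<epsilon> *\<^sub>R w"
        using pos by (simp add: w_def)
      have scale: "dist (x - \<epsilon> *\<^sub>R g) (x + \<epsilon> *\<^sub>R u) = \<epsilon> * dist (- g) u" for u
      proof -
        have "(x - \<epsilon> *\<^sub>R g) - (x + \<epsilon> *\<^sub>R u) = \<epsilon> *\<^sub>R (- g - u)"
          by (simp add: algebra_simps)
        then show ?thesis
          using pos by (simp only: dist_norm norm_scaleR abs_of_pos)
      qed
      have "w \<in> feasible_cone m a b x"
        unfolding w_def using z pos by (intro scaled_displacement_in_feasible_cone) auto
      then have "dist (- g) p \<le> dist (- g) w"
        unfolding p_def by (intro closest_point_le closed_feasible_cone)
      then show ?thesis
        using pos by (simp add: z_eq scale)
    qed
    then show ?thesis
      using closest_point_unique[OF convex_poly_set closed_poly_set feasible] by simp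
  qed
  then show ?thesis
    using eventually_conj[OF eventually_at_right_less eventually_feasible_step[OF x p_in]]
    by (auto elim: eventually_mono)
qed

lemma shadow_eq_closest_point:
  assumes x: "x \<in> poly_set m a b"
  shows "shadow (poly_set m a b) G x = closest_point (feasible_cone m a b x) (- G x)"
    (is "_ = ?p")
proof -
  have "\<forall>\<^sub>F \<epsilon> in at_right 0.
      (closest_point (poly_set m a b) (x - \<epsilon> *\<^sub>R G x) - x) /\<^sub>R \<epsilon> = ?p"
    using closest_point_poly_set_small_step[OF x, of "G x"] eventually_at_right_less[of 0]
    by eventually_elim simp
  then have "((\<lambda>\<epsilon>. (closest_point (poly_set m a b) (x - \<epsilon> *\<^sub>R G x) - x) /\<^sub>R \<epsilon>) \<longlongrightarrow> ?p)
      (at_right 0)"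
    by (rule tendsto_eventually)
  then show ?thesis
    unfolding shadow_def by (intro tendsto_Lim) auto
qed

lemma shadow_in_feasible_cone:
  assumes "x \<in> poly_set m a b"
  shows "shadow (poly_set m a b) G x \<in> feasible_cone m a b x"
  unfolding shadow_eq_closest_point[OF assms]
  by (intro closest_point_in_set closed_feasible_cone feasible_cone_nonempty)

text \<open>
  The maximum is attained because the admissible step lengths form a compact set: it is the preimage
  of \<open>P\<close> under a continuous map, and \<open>d \<noteq> 0\<close> turns a norm bound on \<open>P\<close> into a bound on \<open>\<delta>\<close>. It is
  nonnegative because the zero step is admissible.
\<close>

lemma max_away_step_attained:
  fixes x d :: "real ^ 'n"
  assumes P: "compact P" and x: "x \<in> P" and d: "d \<noteq> 0"
  shows "x - max_away_step P x d *\<^sub>R d \<in> P" and "0 \<le> max_away_step P x d"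
proof -
  define S where "S = {\<delta>. x - \<delta> *\<^sub>R d \<in> P}"
  have "closed S"
  proof -
    have "S = (\<lambda>\<delta>. x - \<delta> *\<^sub>R d) -` P"
      by (auto simp: S_def)
    moreover have "continuous_on UNIV (\<lambda>\<delta>. x - \<delta> *\<^sub>R d)"
      by (intro continuous_intros)
    ultimately show ?thesis
      using P by (simp add: closed_vimage compact_imp_closed)
  qed
  moreover have "bounded S"
  proof -
    obtain B where B: "\<And>y. y \<in> P \<Longrightarrow> norm y \<le> B"
      using compact_imp_bounded[OF P] by (auto simp: bounded_iff)
    have "\<bar>\<delta>\<bar> \<le> (norm x + B) / norm d" if "\<delta> \<in> S" for \<delta>
    proof -
      have "\<bar>\<delta>\<bar> * norm d = norm (x - (x - \<delta> *\<^sub>R d))"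
        by simp
      also have "\<dots> \<le> norm x + norm (x - \<delta> *\<^sub>R d)"
        by (rule norm_triangle_ineq4)
      also have "\<dots> \<le> norm x + B"
        using that B by (simp add: S_def)
      finally show ?thesis
        using d by (simp add: pos_le_divide_eq)
    qed
    then show ?thesis
      by (auto simp: bounded_iff)
  qed
  moreover have zero_in: "0 \<in> S"
    using x by (simp add: S_def)
  ultimately obtain s where s: "s \<in> S" "\<And>t. t \<in> S \<Longrightarrow> t \<le> s"
    using compact_attains_sup[of S] by (auto simp: compact_eq_bounded_closed)
  have "max_away_step P x d = s"
    unfolding max_away_step_def using s by (intro Greatest_equality) (auto simp: S_def)
  then show "x - max_away_step P x d *\<^sub>R d \<in> P" and "0 \<le> max_away_step P x d"
    using s zero_in by (auto simp: S_def)
qed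

lemma backward_step_in_min_face:
  assumes v: "v \<in> feasible_cone m a b x" and "0 \<le> \<delta>"
    and step: "x - \<delta> *\<^sub>R v \<in> poly_set m a b"
  shows "x - \<delta> *\<^sub>R v \<in> min_face m a b x"
proof -
  have "a i \<bullet> (x - \<delta> *\<^sub>R v) = b i" if i: "i \<in> active m a b x" for i
  proof (rule antisym)
    show "a i \<bullet> (x - \<delta> *\<^sub>R v) \<le> b i"
      using step i by (simp add: poly_set_def active_def)
    have "\<delta> * (a i \<bullet> v) \<le> 0"
      using v i \<open>0 \<le> \<delta>\<close> by (simp add: feasible_cone_def mult_nonneg_nonpos)
    then show "b i \<le> a i \<bullet> (x - \<delta> *\<^sub>R v)"
      using i by (simp add: active_def inner_diff_right)
  qed
  then show ?thesis
    using step by (simp add: min_face_def)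
qed

theorem lemma7:
  fixes a :: "nat \<Rightarrow> real ^ 'n" and b :: "nat \<Rightarrow> real" and m :: nat
    and P :: "(real ^ 'n) set"
    and h :: "real ^ 'n \<Rightarrow> real" and grad_h :: "real ^ 'n \<Rightarrow> real ^ 'n"
    and x d :: "real ^ 'n" and \<delta>max :: real
  assumes P_def: "P = poly_set m a b"
    and polytope: "polytope P"
    and gradient: "\<And>y. y \<in> P \<Longrightarrow> (h has_derivative (\<lambda>v. grad_h y \<bullet> v)) (at y within P)"
    and x_in: "x \<in> P"
    and d_def: "d = shadow P grad_h x"
    and \<delta>max_def: "\<delta>max = max_away_step P x d"
  shows "away_point P x d \<in> min_face m a b x \<and> x - away_point P x d = \<delta>max *\<^sub>R d"
proof (cases "d = 0")
  case True
  then show ?thesis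
    using x_in P_def by (simp add: away_point_def min_face_def active_def)
next
  case False
  have d_in: "d \<in> feasible_cone m a b x"
    using shadow_in_feasible_cone x_in unfolding d_def P_def by blast
  have "x - \<delta>max *\<^sub>R d \<in> P" and "0 \<le> \<delta>max"
    using max_away_step_attained[OF polytope_imp_compact[OF polytope] x_in False]
    by (simp_all add: \<delta>max_def)
  then have "x - \<delta>max *\<^sub>R d \<in> min_face m a b x"
    using backward_step_in_min_face[OF d_in] by (simp add: P_def)
  then show ?thesis
    using False by (simp add: away_point_def \<delta>max_def)
qed

end
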